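(* Consider a gossip model on a graph $G=(V,E)$ with link probabilities $p_{ij}$, $\{i,j\}\in E$. Let $P$ be the symmetric matrix with $P_{ij}=p_{ij}$ for $\{i,j\}\in E$, $P_{ii}=0$ for $i=1,\ldots,N$, and $P_{ij}=0$ for $\{i,j\}\notin E$. Then the probability $p_{\max}$ of the most likely maximal disconnected collection and the rate $I$ for this model satisfy $$p_{\max}=1-\mathrm{mincut}(V,E,P),\qquad I=-\log\bigl(1-\mathrm{mincut}(V,E,P)\bigr).$$
   Context: Let $V=\{1,\ldots,N\}$, $E\subseteq\binom V2$. Matrix process. $\{W_k\}_{k\ge1}$ are i.i.d. random $N\times N$ symmetric doubly stochastic matrices for which there is $\delta>0$ such that, for every realization $W$, all positive entries of $W$ are $\ge\delta$ and all diagonal entries satisfy $W_{ii}\ge\delta$. The induced graph of $W$ is $G(W)=(V,\{\{i,j\}:i\ne j,\,W_{ij}>0\})$, and $G_t=G(W_t)$. Gossip model on $(V,E)$: at each time exactly one link of $E$ is active, i.e. the set of realizable graphs is $\mathcal G=\{(V,\{\{i,j\}\}):\{i,j\}\in E\}$, with $p_{ij}=\mathbb P(G_t=(V,\{\{i,j\}\}))$, so that $\sum_{\{i,j\}\in E}p_{ij}=1$. Disconnected collections. For $\mathcal H\subseteq\mathcal G$, $\Gamma(\mathcal H)=(V,\bigcup_{G\in\mathcal H}E(G))$ and $p_{\mathcal H}=\sum_{H\in\mathcal H}\mathbb P(G_t=H)$. A nonempty $\mathcal H\subseteq\mathcal G$ is a maximal disconnected collection if $\Gamma(\mathcal H)$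 is disconnected and $\Gamma(\mathcal H\cup\{G\})$ is connected for every $G\in\mathcal G\setminus\mathcal H$; $\Pi^\star(\mathcal G)$ is the set of these, and $p_{\max}=\max_{\mathcal H\in\Pi^\star(\mathcal G)}p_{\mathcal H}$, with $p_{\max}=0$ if $\Pi^\star(\mathcal G)=\emptyset$. Rate. $I\in[0,+\infty]$ is the exponential rate of consensus: $\lim_{k\to\infty}\frac1k\log\mathbb P(\|W_k\cdots W_1-J\|\ge\epsilon)=-I$ for every $\epsilon\in(0,1]$, where $J=\frac1N\mathbf 1\mathbf 1^\top$ and $\|\cdot\|$ is the spectral norm; it equals $|\log p_{\max}|$ if $\Pi^\star(\mathcal G)\ne\emptyset$ and $+\infty$ otherwise. Convention: $\log 0=-\infty$. Min-cut. For nonnegative edge costs collected in $C=[c_{ij}]$ (with $c_{ii}=0$ and $c_{ij}=0$ for $\{i,j\}\notin E$), $\mathrm{mincut}(V,E,C)$ is the minimum of $\sum_{\{i,j\}\in F}c_{ij}$ over all $F\subseteq E$ such that $(V,E\setminus F)$ is disconnected. *)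

theory Defs
  imports "HOL-Probability.Probability"
begin

text \<open>
  An undirected graph is a pair of a vertex set and a set of two-element edges. The vertex set
  \<open>{1, \<dots>, N}\<close> is rendered by a finite type \<open>'n\<close> with \<open>N = CARD('n)\<close>.
\<close>

type_synonym 'v ugraph = "'v set \<times> 'v set set"

definition graph_connected :: "'v ugraph \<Rightarrow> bool" where
  "graph_connected G \<longleftrightarrow>
     (\<forall>u\<in>fst G. \<forall>v\<in>fst G. (u, v) \<in> {(x, y). x \<in> fst G \<and> y \<in> fst G \<and> {x, y} \<in> snd G}\<^sup>*)"

text \<open>Well defined when \<open>C\<close> is symmetric, since then both orderings of \<open>e\<close> give the same entry.\<close>

definition edge_cost :: "real ^ 'n ^ 'n \<Rightarrow> 'n set \<Rightarrow> real" where
  "edge_cost C e = (THE c. \<forall>i j. e = {i, j} \<longrightarrow> c = C $ i $ j)"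

text \<open>The minimum exists whenever \<open>V\<close> has at least two vertices, because \<open>F = E\<close> is then a cut.\<close>

definition mincut :: "'n set \<Rightarrow> 'n set set \<Rightarrow> real ^ 'n ^ 'n \<Rightarrow> real" where
  "mincut V E C = Min {\<Sum>e\<in>F. edge_cost C e | F. F \<subseteq> E \<and> \<not> graph_connected (V, E - F)}"

definition sym_doubly_stochastic :: "real ^ 'n ^ 'n \<Rightarrow> bool" where
  "sym_doubly_stochastic A \<longleftrightarrow>
     transpose A = A \<and> (\<forall>i j. 0 \<le> A $ i $ j) \<and>
     (\<forall>i. (\<Sum>j\<in>UNIV. A $ i $ j) = 1) \<and> (\<forall>j. (\<Sum>i\<in>UNIV. A $ i $ j) = 1)"

definition entries_bounded_below :: "real \<Rightarrow> real ^ 'n ^ 'n \<Rightarrow> bool" where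
  "entries_bounded_below \<delta> A \<longleftrightarrow>
     (\<forall>i j. 0 < A $ i $ j \<longrightarrow> \<delta> \<le> A $ i $ j) \<and> (\<forall>i. \<delta> \<le> A $ i $ i)"

definition induced_graph :: "real ^ 'n ^ 'n \<Rightarrow> 'n ugraph" where
  "induced_graph A = (UNIV, {{i, j} | i j. i \<noteq> j \<and> 0 < A $ i $ j})"

definition iid_matrices :: "'a measure \<Rightarrow> (nat \<Rightarrow> 'a \<Rightarrow> real ^ 'n ^ 'n) \<Rightarrow> bool" where
  "iid_matrices M W \<longleftrightarrow>
     prob_space M \<and> prob_space.indep_vars M (\<lambda>_. borel) W {1..} \<and>
     (\<forall>k\<ge>1. distr M borel (W k) = distr M borel (W 1))"

definition matrix_process :: "'a measure \<Rightarrow> (nat \<Rightarrow> 'a \<Rightarrow> real ^ 'n ^ 'n) \<Rightarrow> real \<Rightarrow> bool" where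
  "matrix_process M W \<delta> \<longleftrightarrow>
     iid_matrices M W \<and> 0 < \<delta> \<and>
     (\<forall>k\<ge>1. AE \<omega> in M. sym_doubly_stochastic (W k \<omega>) \<and> entries_bounded_below \<delta> (W k \<omega>))"

definition graph_prob :: "'a measure \<Rightarrow> ('a \<Rightarrow> real ^ 'n ^ 'n) \<Rightarrow> 'n ugraph \<Rightarrow> real" where
  "graph_prob M A G = measure M {\<omega> \<in> space M. induced_graph (A \<omega>) = G}"

definition gossip_graphs :: "'n set set \<Rightarrow> 'n ugraph set" where
  "gossip_graphs E = {(UNIV, {e}) | e. e \<in> E}"

definition gossip_model ::
    "'a measure \<Rightarrow> (nat \<Rightarrow> 'a \<Rightarrow> real ^ 'n ^ 'n) \<Rightarrow> real \<Rightarrow> 'n set set \<Rightarrow> bool" where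
  "gossip_model M W \<delta> E \<longleftrightarrow>
     E \<subseteq> {e. card e = 2} \<and> matrix_process M W \<delta> \<and>
     (\<forall>t\<ge>1. AE \<omega> in M. induced_graph (W t \<omega>) \<in> gossip_graphs E)"

definition graph_union :: "'n ugraph set \<Rightarrow> 'n ugraph" where
  "graph_union \<H> = (UNIV, \<Union>G\<in>\<H>. snd G)"

definition max_disconnected_collections :: "'n ugraph set \<Rightarrow> 'n ugraph set set" where
  "max_disconnected_collections \<G> =
     {\<H>. \<H> \<noteq> {} \<and> \<H> \<subseteq> \<G> \<and> \<not> graph_connected (graph_union \<H>) \<and>
          (\<forall>G\<in>\<G> - \<H>. graph_connected (graph_union (\<H> \<union> {G})))}"

definition collection_prob ::
    "'a measure \<Rightarrow> ('a \<Rightarrow> real ^ 'n ^ 'n) \<Rightarrow> 'n ugraph set \<Rightarrow> real" where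
  "collection_prob M A \<H> = (\<Sum>H\<in>\<H>. graph_prob M A H)"

definition p_max :: "'a measure \<Rightarrow> ('a \<Rightarrow> real ^ 'n ^ 'n) \<Rightarrow> 'n ugraph set \<Rightarrow> real" where
  "p_max M A \<G> =
     (if max_disconnected_collections \<G> = {} then 0
      else Max (collection_prob M A ` max_disconnected_collections \<G>))"

text \<open>The natural logarithm on \<open>[0, \<infinity>)\<close> with \<open>log 0 = -\<infinity>\<close> (\<open>ln\<close> itself has \<open>ln 0 = 0\<close>).\<close>

definition elog :: "real \<Rightarrow> ereal" where
  "elog x = (if x \<le> 0 then -\<infinity> else ereal (ln x))"

primrec matrix_product :: "(nat \<Rightarrow> 'a \<Rightarrow> real ^ 'n ^ 'n) \<Rightarrow> nat \<Rightarrow> 'a \<Rightarrow> real ^ 'n ^ 'n" where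
  "matrix_product W 0 \<omega> = mat 1"
| "matrix_product W (Suc k) \<omega> = W (Suc k) \<omega> ** matrix_product W k \<omega>"

definition averaging_matrix :: "real ^ 'n ^ 'n" where
  "averaging_matrix = (\<chi> i j. 1 / real CARD('n))"

text \<open>The default \<open>norm\<close> on matrices is the Frobenius norm, hence the operator norm here.\<close>

definition spectral_norm :: "real ^ 'n ^ 'n \<Rightarrow> real" where
  "spectral_norm A = onorm (\<lambda>x. A *v x)"

definition has_consensus_rate ::
    "'a measure \<Rightarrow> (nat \<Rightarrow> 'a \<Rightarrow> real ^ 'n ^ 'n) \<Rightarrow> ereal \<Rightarrow> bool" where
  "has_consensus_rate M W I \<longleftrightarrow>
     0 \<le> I \<and>
     (\<forall>\<epsilon>. 0 < \<epsilon> \<and> \<epsilon> \<le> 1 \<longrightarrow>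
       (\<lambda>k. ereal (1 / real k) *
            elog (measure M {\<omega> \<in> space M.
                    spectral_norm (matrix_product W k \<omega> - averaging_matrix) \<ge> \<epsilon>}))
       \<longlonglongrightarrow> - I)"

end

theory Submission
  imports Defs
begin

text \<open>
  Write \<open>q = 1 - mincut\<close>; complementing cuts, \<open>q\<close> is the largest probability of a set of edges that
  does not connect the vertices, and by maximal extension of such a set it is also \<open>p_max\<close>.

  The rate is at most \<open>- log q\<close>, because with probability \<open>q^k\<close> only links of an optimal disconnected
  set are active up to time \<open>k\<close>, and then the centred indicator of a component is a fixed vector.

  For the other bound, let \<open>x\<close> be a state with deviation (squared distance to consensus) \<open>v > 0\<close>. The
  links along which \<open>x\<close> varies little form a disconnected set, so that one of them is active with
  probability at most \<open>q\<close>; any other link shrinks the deviation by a factor \<open>b < 1\<close> that depends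
  neither on \<open>x\<close> nor on the time. Hence the \<open>s\<close>-th moment of the deviation after one step is at most
  \<open>(q + b^s) v^s\<close>. Iterating by independence, Markov's inequality gives a tail bound
  \<open>C s * (q + b^s)^k\<close>, and letting \<open>s\<close> tend to infinity after \<open>k\<close> yields the exponent \<open>log q\<close>.
\<close>

section \<open>Contraction of the deviation\<close>

text \<open>Squared distance of \<open>x\<close> to the line of constant vectors, in quadratic form:
  an update that preserves the sum of the entries changes only \<open>x \<bullet> x\<close>.\<close>

definition deviation :: "real ^ 'n \<Rightarrow> real" where
  "deviation x = x \<bullet> x - (\<Sum>i\<in>UNIV. x $ i)\<^sup>2 / real CARD('n)"

lemma deviation_eq_norm:
  fixes x :: "real ^ 'n"
  shows "deviation x = (norm (x - (\<chi> i. (\<Sum>j\<in>UNIV. x $ j) / real CARD('n))))\<^sup>2"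
proof -
  define s where "s = (\<Sum>j\<in>UNIV. x $ j)"
  have "(norm (x - (\<chi> i. s / real CARD('n))))\<^sup>2
      = (\<Sum>i\<in>UNIV. (x $ i)\<^sup>2 - 2 * (s / real CARD('n)) * x $ i + (s / real CARD('n))\<^sup>2)"
    unfolding power2_norm_eq_inner inner_vec_def
    by (intro sum.cong refl) (simp add: power2_eq_square algebra_simps)
  also have "\<dots> = x \<bullet> x - 2 * (s / real CARD('n)) * s + s\<^sup>2 / real CARD('n)"
    unfolding sum.distrib sum_subtractf sum_distrib_left[symmetric]
    by (simp add: inner_vec_def power2_eq_square s_def)
  also have "\<dots> = deviation x"
    by (simp add: deviation_def s_def power2_eq_square)
  finally show ?thesis by (simp add: s_def)
qed

lemma deviation_nonneg: "0 \<le> deviation x"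
  by (simp add: deviation_eq_norm)

text \<open>An entry minus the mean is the mean of its differences to all entries; in this form,
  bounds on pairwise differences carry over to the deviation.\<close>

lemma deviation_eq_sum:
  fixes x :: "real ^ 'n"
  shows "deviation x = (\<Sum>i\<in>UNIV. ((\<Sum>j\<in>UNIV. x $ i - x $ j) / real CARD('n))\<^sup>2)"
  unfolding deviation_eq_norm power2_norm_eq_inner inner_vec_def
  by (intro sum.cong refl) (simp add: power2_eq_square sum_subtractf diff_divide_distrib)

lemma deviation_le:
  fixes x :: "real ^ 'n"
  assumes "\<And>i j. \<bar>x $ i - x $ j\<bar> \<le> m"
  shows "deviation x \<le> real CARD('n) * m\<^sup>2"
proof -
  have "((\<Sum>j\<in>UNIV. x $ i - x $ j) / real CARD('n))\<^sup>2 \<le> m\<^sup>2" for i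
  proof -
    have "\<bar>\<Sum>j\<in>UNIV. x $ i - x $ j\<bar> \<le> (\<Sum>j\<in>(UNIV::'n set). m)"
      using assms by (intro order_trans[OF sum_abs] sum_mono) auto
    then have "\<bar>(\<Sum>j\<in>UNIV. x $ i - x $ j) / real CARD('n)\<bar> \<le> m"
      by (simp add: divide_simps mult.commute)
    then show ?thesis
      using power_mono[OF _ abs_ge_zero] power2_abs by metis
  qed
  then have "deviation x \<le> (\<Sum>i\<in>(UNIV::'n set). m\<^sup>2)"
    unfolding deviation_eq_sum by (intro sum_mono) auto
  then show ?thesis by simp
qed

section \<open>Connected graphs and small differences along links\<close>

lemma graph_connected_UNIV:
  "graph_connected (UNIV, D) \<longleftrightarrow> (\<forall>u v. (u, v) \<in> {(x, y). {x, y} \<in> D}\<^sup>*)"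
  by (simp add: graph_connected_def)

lemma relpow_abs_diff_le:
  fixes f :: "'v \<Rightarrow> real"
  assumes "\<And>x y. (x, y) \<in> R \<Longrightarrow> \<bar>f x - f y\<bar> \<le> m" "(u, v) \<in> R ^^ k"
  shows "\<bar>f u - f v\<bar> \<le> real k * m"
  using assms(2)
proof (induction k arbitrary: v)
  case (Suc k)
  then obtain w where "(u, w) \<in> R ^^ k" "(w, v) \<in> R" by auto
  with Suc.IH assms(1) have "\<bar>f u - f w\<bar> \<le> real k * m" "\<bar>f w - f v\<bar> \<le> m" by auto
  then show ?case by (simp add: algebra_simps)
qed auto

text \<open>Differences add up along a walk. Its length is bounded crudely by the number of ordered
  pairs of vertices; all that matters is that the bound depends only on the number of
  vertices.\<close>

lemma connected_abs_diff_le: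
  fixes f :: "'n::finite \<Rightarrow> real"
  assumes "graph_connected (UNIV, D)" "0 \<le> m"
    and "\<And>x y. {x, y} \<in> D \<Longrightarrow> \<bar>f x - f y\<bar> \<le> m"
  shows "\<bar>f u - f v\<bar> \<le> (real CARD('n))\<^sup>2 * m"
proof -
  let ?R = "{(x, y). {x, y} \<in> D}"
  have "(u, v) \<in> ?R\<^sup>*" using assms(1) by (simp add: graph_connected_UNIV)
  then obtain k where k: "k \<le> card ?R" "(u, v) \<in> ?R ^^ k"
    by (subst (asm) rtrancl_finite_eq_relpow) auto
  have "card ?R \<le> card (UNIV :: ('n \<times> 'n) set)"
    by (rule card_mono) auto
  then have "card ?R \<le> (CARD('n))\<^sup>2"
    by (simp add: card_cartesian_product power2_eq_square flip: UNIV_Times_UNIV)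
  with k(1) have "real k \<le> real ((CARD('n))\<^sup>2)"
    by (intro of_nat_mono) linarith
  then have "real k * m \<le> (real CARD('n))\<^sup>2 * m"
    using assms(2) by (intro mult_right_mono) auto
  moreover have "\<bar>f u - f v\<bar> \<le> real k * m"
    by (rule relpow_abs_diff_le[OF _ k(2)]) (use assms(3) in auto)
  ultimately show ?thesis by linarith
qed

text \<open>Suppose \<open>D\<close> connects the N vertices. Then all differences are at most N^2 m
  with m^2 = \<open>\<eta> * deviation x\<close>, so the deviation is at most N (N^2 m)^2 = N^5
  \<eta> times itself. This is the origin of the fifth power.\<close>

lemma small_increments_disconnected:
  fixes x :: "real ^ 'n"
  assumes "0 < deviation x" "0 < \<eta>" "\<eta> * real CARD('n) ^ 5 < 1"
    and "\<And>i j. {i, j} \<in> D \<Longrightarrow> (x $ i - x $ j)\<^sup>2 \<le> \<eta> * deviation x"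
  shows "\<not> graph_connected (UNIV, D)"
proof
  assume conn: "graph_connected (UNIV, D)"
  define m where "m = sqrt (\<eta> * deviation x)"
  have m: "0 \<le> m" "m\<^sup>2 = \<eta> * deviation x"
    using assms(1,2) by (simp_all add: m_def)
  have "\<bar>x $ i - x $ j\<bar> \<le> m" if "{i, j} \<in> D" for i j
    using assms(4)[OF that] unfolding m_def by (intro real_le_rsqrt) simp
  from connected_abs_diff_le[OF conn m(1), of "\<lambda>i. x $ i", OF this]
  have "deviation x \<le> real CARD('n) * ((real CARD('n))\<^sup>2 * m)\<^sup>2"
    by (intro deviation_le) auto
  also have "\<dots> = (\<eta> * real CARD('n) ^ 5) * deviation x"
    by (simp add: power_mult_distrib m(2) flip: power_mult) (simp add: eval_nat_numeral algebra_simps)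
  also have "\<dots> < 1 * deviation x"
    using assms by (intro mult_strict_right_mono) auto
  finally show False by simp
qed

text \<open>All off-diagonal weight sits on one link and rows sum to 1, so \<open>w\<close> is the
  identity minus \<open>w $ i $ j\<close> times the rank-one matrix h h^T with h =
  \<open>axis i 1 - axis j 1\<close>.\<close>

lemma gossip_matrix_vector_mult:
  fixes w :: "real ^ 'n ^ 'n"
  assumes ds: "sym_doubly_stochastic w" and g: "induced_graph w = (UNIV, {{i, j}})" and ij: "i \<noteq> j"
  shows "w *v x = x - (w $ i $ j * (x $ i - x $ j)) *\<^sub>R (axis i 1 - axis j 1)"
proof -
  have nn: "0 \<le> w $ k $ l" and row: "(\<Sum>l\<in>UNIV. w $ k $ l) = 1" for k l
    using ds by (auto simp: sym_doubly_stochastic_def)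
  have sym: "w $ j $ i = w $ i $ j"
    using ds by (simp add: sym_doubly_stochastic_def transpose_def vec_eq_iff)
  have "{k, l} = {i, j}" if "k \<noteq> l" "0 < w $ k $ l" for k l
  proof -
    have "{k, l} \<in> snd (induced_graph w)" using that by (auto simp: induced_graph_def)
    then show ?thesis using g by simp
  qed
  then have off: "w $ k $ l = 0" if "k \<noteq> l" "{k, l} \<noteq> {i, j}" for k l
    using nn[of k l] that by (metis less_eq_real_def)
  \<comment> \<open>Unit row sums express the increment through differences, so the diagonal entry
    drops out.\<close>
  have eq: "(w *v x) $ k - x $ k = (\<Sum>l\<in>UNIV. w $ k $ l * (x $ l - x $ k))" for k
    using row[of k] by (simp add: matrix_vector_mult_def algebra_simps sum_subtractf flip: sum_distrib_left)
  have "(w *v x) $ k - x $ k = - (w $ i $ j * (x $ i - x $ j)) * (axis i 1 $ k - axis j 1 $ k)" for k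
  proof -
    \<comment> \<open>Away from \<open>l\<close>, the term at \<open>k\<close> vanishes through its
      difference factor and all others through their weight.\<close>
    have *: "(\<Sum>l\<in>UNIV. w $ k $ l * (x $ l - x $ k)) = w $ k $ l * (x $ l - x $ k)"
      if "\<And>l'. l' \<noteq> l \<Longrightarrow> l' \<noteq> k \<Longrightarrow> w $ k $ l' = 0" for l
    proof -
      have "w $ k $ l' * (x $ l' - x $ k) = 0" if "l' \<noteq> l" for l'
        using \<open>\<And>l'. l' \<noteq> l \<Longrightarrow> l' \<noteq> k \<Longrightarrow> w $ k $ l' = 0\<close>[OF that] by (cases "l' = k") auto
      then have "(\<Sum>l'\<in>UNIV - {l}. w $ k $ l' * (x $ l' - x $ k)) = 0"
        by (intro sum.neutral) blast
      then show ?thesis by (simp add: sum.remove[of UNIV l])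
    qed
    consider "k = i" | "k = j" | "k \<noteq> i" "k \<noteq> j" by blast
    then show ?thesis
    proof cases
      case 1
      then have "(w *v x) $ k - x $ k = w $ k $ j * (x $ j - x $ k)"
        unfolding eq by (intro *) (auto intro!: off simp: doubleton_eq_iff)
      with 1 ij show ?thesis by (simp add: axis_def algebra_simps)
    next
      case 2
      then have "(w *v x) $ k - x $ k = w $ k $ i * (x $ i - x $ k)"
        unfolding eq by (intro *) (auto intro!: off simp: doubleton_eq_iff)
      with 2 ij sym show ?thesis by (simp add: axis_def algebra_simps)
    next
      \<comment> \<open>The link does not touch \<open>k\<close>: the surviving index is
        \<open>k\<close> itself, and its term is zero.\<close>
      case 3
      then have "(w *v x) $ k - x $ k = w $ k $ k * (x $ k - x $ k)"
        unfolding eq by (intro *) (auto intro!: off simp: doubleton_eq_iff)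
      with 3 show ?thesis by (simp add: axis_def)
    qed
  qed
  then show ?thesis
    unfolding vec_eq_iff by (auto simp: algebra_simps)
qed

lemma gossip_matrix_fixes:
  fixes w :: "real ^ 'n ^ 'n"
  assumes "sym_doubly_stochastic w" "induced_graph w = (UNIV, {{i, j}})" "i \<noteq> j" "x $ i = x $ j"
  shows "w *v x = x"
  using gossip_matrix_vector_mult[OF assms(1-3), of x] assms(4) by simp

text \<open>The sum of the entries is preserved, and since x.h = d and h.h = 2, the squared norm
  drops by exactly 2 a (1 - a) d^2, where a is the weight of the link and d the difference across
  it.\<close>

lemma gossip_matrix_deviation:
  fixes w :: "real ^ 'n ^ 'n"
  assumes ds: "sym_doubly_stochastic w" and lb: "entries_bounded_below \<delta> w"
    and g: "induced_graph w = (UNIV, {{i, j}})" and ij: "i \<noteq> j" and "0 < \<delta>"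
  shows "deviation (w *v x) \<le> deviation x - \<delta> * (x $ i - x $ j)\<^sup>2"
proof -
  define a where "a = w $ i $ j"
  define d where "d = x $ i - x $ j"
  define h :: "real ^ 'n" where "h = axis i 1 - axis j 1"
  have wx: "w *v x = x - (a * d) *\<^sub>R h"
    using gossip_matrix_vector_mult[OF ds g ij] by (simp add: a_def d_def h_def)
  have xh: "x \<bullet> h = d" and hh: "h \<bullet> h = 2"
    using ij by (simp_all add: h_def d_def inner_diff_right inner_diff_left inner_axis) (simp add: axis_def)+
  have sh: "(\<Sum>k\<in>UNIV. h $ k) = 0"
    by (simp add: h_def axis_def sum_subtractf)
  have "{i, j} \<in> snd (induced_graph w)" using g by simp
  then have "0 < w $ i $ j \<or> 0 < w $ j $ i"
    by (auto simp: induced_graph_def doubleton_eq_iff)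
  moreover have "w $ j $ i = w $ i $ j"
    using ds by (simp add: sym_doubly_stochastic_def transpose_def vec_eq_iff)
  ultimately have a: "\<delta> \<le> a"
    using lb by (auto simp: entries_bounded_below_def a_def)
  have "w $ i $ i + a \<le> 1"
  proof -
    have "(\<Sum>l\<in>{i, j}. w $ i $ l) \<le> (\<Sum>l\<in>UNIV. w $ i $ l)"
      using ds by (intro sum_mono2) (auto simp: sym_doubly_stochastic_def)
    then show ?thesis
      using ds ij by (simp add: sym_doubly_stochastic_def a_def)
  qed
  moreover have "\<delta> \<le> w $ i $ i" using lb by (simp add: entries_bounded_below_def)
  \<comment> \<open>The bound on the diagonal keeps \<open>a\<close> away from 1, where the two
    entries would merely be swapped.\<close>
  ultimately have a': "\<delta> \<le> 1 - a" by simp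
  \<comment> \<open>Both \<open>a\<close> and \<open>1 - a\<close> are at least
    \<open>\<delta>\<close>, and the larger of them is at least 1/2, which absorbs the factor
    2.\<close>
  have aa: "\<delta> \<le> 2 * a * (1 - a)"
  proof (cases "a \<le> 1 / 2")
    case True
    then have "\<delta> * 1 \<le> a * (2 * (1 - a))" using a assms(5) by (intro mult_mono) auto
    then show ?thesis by (simp add: algebra_simps)
  next
    case False
    then have "1 * \<delta> \<le> (2 * a) * (1 - a)" using a' assms(5) by (intro mult_mono) auto
    then show ?thesis by simp
  qed
  have "(\<Sum>k\<in>UNIV. (w *v x) $ k) = (\<Sum>k\<in>UNIV. x $ k)"
    using sh by (simp add: wx sum_subtractf flip: sum_distrib_left)
  moreover have "(w *v x) \<bullet> (w *v x) = x \<bullet> x - 2 * a * (1 - a) * d\<^sup>2"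
    by (simp add: wx inner_diff_left inner_diff_right xh hh inner_commute[of h x] power2_eq_square algebra_simps)
  ultimately have "deviation (w *v x) = deviation x - 2 * a * (1 - a) * d\<^sup>2"
    by (simp add: deviation_def)
  moreover have "\<delta> * d\<^sup>2 \<le> 2 * a * (1 - a) * d\<^sup>2"
    using aa by (intro mult_right_mono) auto
  ultimately show ?thesis by (simp add: d_def)
qed

section \<open>Disconnected collections and cuts\<close>

text \<open>The graph depends only on the set of positive entries, which takes finitely many values,
  so the event is a finite union of sign-pattern events.\<close>

lemma measurable_induced_graph:
  fixes A :: "'a \<Rightarrow> real ^ 'n ^ 'n"
  assumes [measurable]: "A \<in> borel_measurable M"
  shows "{\<omega> \<in> space M. induced_graph (A \<omega>) \<in> S} \<in> sets M"
proof -
  define supp :: "real ^ 'n ^ 'n \<Rightarrow> ('n \<times> 'n) set" where "supp w = {(i, j). 0 < w $ i $ j}" for w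
  have induced: "induced_graph w = (UNIV, {{i, j} | i j. i \<noteq> j \<and> (i, j) \<in> supp w})" for w
    by (simp add: induced_graph_def supp_def)
  have "{\<omega> \<in> space M. supp (A \<omega>) = T} \<in> sets M" for T
  proof -
    have "{\<omega> \<in> space M. supp (A \<omega>) = T}
        = {\<omega> \<in> space M. \<forall>i j. 0 < A \<omega> $ i $ j \<longleftrightarrow> (i, j) \<in> T}"
      by (auto simp: supp_def)
    moreover have "(\<lambda>\<omega>. A \<omega> $ i $ j) \<in> borel_measurable M" for i j
      by (intro borel_measurable_continuous_on[OF _ assms]) (intro continuous_intros)
    then have "{\<omega> \<in> space M. \<forall>i j. 0 < A \<omega> $ i $ j \<longleftrightarrow> (i, j) \<in> T} \<in> sets M"
      by measurable
    ultimately show ?thesis by simp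
  qed
  then have "(\<Union>T\<in>{T. (UNIV, {{i, j} | i j. i \<noteq> j \<and> (i, j) \<in> T}) \<in> S}.
      {\<omega> \<in> space M. supp (A \<omega>) = T}) \<in> sets M"
    by (intro sets.finite_UN) auto
  also have "(\<Union>T\<in>{T. (UNIV, {{i, j} | i j. i \<noteq> j \<and> (i, j) \<in> T}) \<in> S}.
      {\<omega> \<in> space M. supp (A \<omega>) = T}) = {\<omega> \<in> space M. induced_graph (A \<omega>) \<in> S}"
    by (auto simp: induced)
  finally show ?thesis .
qed

lemma measurable_induced_graph_borel:
  "{w :: real ^ 'n ^ 'n. induced_graph w \<in> S} \<in> sets borel"
  using measurable_induced_graph[of "\<lambda>w. w" borel S] by simp

lemma gossip_graphs_eq_image: "gossip_graphs E = (\<lambda>e. (UNIV, {e})) ` E"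
  by (auto simp: gossip_graphs_def)

lemma sum_graph_prob:
  fixes A :: "'a \<Rightarrow> real ^ 'n ^ 'n"
  assumes "prob_space M" "A \<in> borel_measurable M"
  shows "(\<Sum>e\<in>D. graph_prob M A (UNIV, {e}))
       = measure M {\<omega> \<in> space M. induced_graph (A \<omega>) \<in> gossip_graphs D}"
proof -
  interpret prob_space M by fact
  have "(\<Sum>e\<in>D. graph_prob M A (UNIV, {e}))
      = (\<Sum>e\<in>D. prob {\<omega> \<in> space M. induced_graph (A \<omega>) = (UNIV, {e})})"
    by (simp add: graph_prob_def)
  also have "\<dots> = prob (\<Union>e\<in>D. {\<omega> \<in> space M. induced_graph (A \<omega>) = (UNIV, {e})})"
    using measurable_induced_graph[OF assms(2), of "{g}" for g]
    by (intro finite_measure_finite_Union[symmetric]) (auto simp: disjoint_family_on_def)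
  also have "(\<Union>e\<in>D. {\<omega> \<in> space M. induced_graph (A \<omega>) = (UNIV, {e})})
      = {\<omega> \<in> space M. induced_graph (A \<omega>) \<in> gossip_graphs D}"
    by (auto simp: gossip_graphs_def)
  finally show ?thesis .
qed

section \<open>Cuts and disconnected sets of links\<close>

lemma edge_cost_eq:
  assumes "e = {i, j}" "\<And>i j. e = {i, j} \<Longrightarrow> C $ i $ j = c"
  shows "edge_cost C e = c"
  unfolding edge_cost_def
proof (rule the_equality)
  fix d assume "\<forall>i j. e = {i, j} \<longrightarrow> d = C $ i $ j"
  with assms show "d = c" by metis
qed (use assms(2) in auto)

text \<open>A link provides two distinct vertices. Hence removing all links is a cut, and the
  minimum in \<open>mincut\<close> is over a nonempty set.\<close>

lemma not_graph_connected_empty: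
  assumes "card (e :: 'n::finite set) = 2"
  shows "\<not> graph_connected (UNIV :: 'n set, {})"
proof -
  obtain i j where "e = {i, j}" "i \<noteq> j" using assms by (meson card_2_iff)
  then show ?thesis by (auto simp: graph_connected_UNIV)
qed

text \<open>With total cost 1, complementation in \<open>E\<close> exchanges cuts with disconnected
  sets and cost c with 1 - c, so a minimum becomes a maximum. The two conclusions are attainment and
  upper bound.\<close>

lemma mincut_complement:
  fixes E :: "'n::finite set set"
  assumes "\<not> graph_connected (UNIV :: 'n set, {})" "(\<Sum>e\<in>E. edge_cost C e) = 1"
  shows "\<exists>D\<subseteq>E. \<not> graph_connected (UNIV, D) \<and> (\<Sum>e\<in>D. edge_cost C e) = 1 - mincut UNIV E C"
    and "D \<subseteq> E \<Longrightarrow> \<not> graph_connected (UNIV, D) \<Longrightarrow> (\<Sum>e\<in>D. edge_cost C e) \<le> 1 - mincut UNIV E C"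
proof -
  let ?S = "{\<Sum>e\<in>F. edge_cost C e | F. F \<subseteq> E \<and> \<not> graph_connected (UNIV, E - F)}"
  have fin: "finite ?S" by simp
  have ne: "?S \<noteq> {}" using assms(1) by (auto intro!: exI[of _ E])
  have compl: "(\<Sum>e\<in>E - F. edge_cost C e) = 1 - (\<Sum>e\<in>F. edge_cost C e)" if "F \<subseteq> E" for F
    using that assms(2) by (subst sum_diff) auto
  have "mincut UNIV E C \<in> ?S"
    unfolding mincut_def by (rule Min_in[OF fin ne])
  then obtain F where "F \<subseteq> E" "\<not> graph_connected (UNIV, E - F)" "mincut UNIV E C = (\<Sum>e\<in>F. edge_cost C e)"
    by auto
  then show "\<exists>D\<subseteq>E. \<not> graph_connected (UNIV, D) \<and> (\<Sum>e\<in>D. edge_cost C e) = 1 - mincut UNIV E C"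
    using compl by (intro exI[of _ "E - F"]) auto
  assume D: "D \<subseteq> E" "\<not> graph_connected (UNIV, D)"
  then have "E - (E - D) = D" by auto
  with D have "(\<Sum>e\<in>E - D. edge_cost C e) \<in> ?S" by (auto intro!: exI[of _ "E - D"])
  then have "mincut UNIV E C \<le> (\<Sum>e\<in>E - D. edge_cost C e)"
    unfolding mincut_def by (intro Min_le[OF fin])
  then show "(\<Sum>e\<in>D. edge_cost C e) \<le> 1 - mincut UNIV E C"
    using compl[of D] D by simp
qed

section \<open>Maximal disconnected collections\<close>

lemma graph_union_gossip_graphs: "graph_union (gossip_graphs D) = (UNIV, D)"
  by (auto simp: graph_union_def gossip_graphs_def)

lemma collection_prob_gossip_graphs:
  "collection_prob M A (gossip_graphs D) = (\<Sum>e\<in>D. graph_prob M A (UNIV, {e}))"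
  unfolding collection_prob_def gossip_graphs_eq_image
  by (subst sum.reindex) (auto simp: inj_on_def)

lemma subset_gossip_graphs:
  assumes "\<H> \<subseteq> gossip_graphs E"
  obtains D where "D \<subseteq> E" "\<H> = gossip_graphs D"
  using assms unfolding gossip_graphs_eq_image by (metis subset_image_iff)

text \<open>Take an inclusion-maximal disconnected superset of \<open>D\<close> inside the finite
  set \<open>E\<close>; any further link connects it. It inherits from \<open>D\<close> the
  nonemptiness demanded of a collection.\<close>

lemma disconnected_extends_to_maximal:
  fixes E :: "'n::finite set set"
  assumes "D \<subseteq> E" "D \<noteq> {}" "\<not> graph_connected (UNIV, D)"
  shows "\<exists>D'\<subseteq>E. D \<subseteq> D' \<and> gossip_graphs D' \<in> max_disconnected_collections (gossip_graphs E)"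
proof -
  let ?A = "{D'. D' \<subseteq> E \<and> \<not> graph_connected (UNIV, D')}"
  obtain D' where D': "D \<subseteq> D'" "D' \<in> ?A" and max: "\<And>B. B \<in> ?A \<Longrightarrow> D' \<subseteq> B \<Longrightarrow> B = D'"
  proof -
    have "finite ?A" "D \<in> ?A" using assms by auto
    from finite_has_maximal2[OF this] that show ?thesis by (metis (no_types, lifting))
  qed
  have "graph_connected (graph_union (gossip_graphs D' \<union> {G}))"
    if G: "G \<in> gossip_graphs E - gossip_graphs D'" for G
  proof -
    obtain e where e: "G = (UNIV, {e})" "e \<in> E" "e \<notin> D'"
      using G by (auto simp: gossip_graphs_def)
    have "gossip_graphs D' \<union> {G} = gossip_graphs (insert e D')"
      using e by (auto simp: gossip_graphs_def)
    moreover have "graph_connected (UNIV, insert e D')"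
      using max[of "insert e D'"] D' e by auto
    ultimately show ?thesis by (simp add: graph_union_gossip_graphs)
  qed
  then have "gossip_graphs D' \<in> max_disconnected_collections (gossip_graphs E)"
    using D' assms(2)
    by (auto simp: max_disconnected_collections_def graph_union_gossip_graphs) (auto simp: gossip_graphs_def)
  with D' show ?thesis by auto
qed

text \<open>Each maximal collection comes from a disconnected set of links, so \<open>q\<close>
  bounds its probability. Conversely, extending \<open>D\<^sub>0\<close> to a maximal collection can
  only add nonnegative probabilities.\<close>

lemma p_max_gossip_eq:
  fixes A :: "'a \<Rightarrow> real ^ 'n ^ 'n" and E :: "'n set set"
  assumes attained: "D\<^sub>0 \<subseteq> E" "\<not> graph_connected (UNIV, D\<^sub>0)" "(\<Sum>e\<in>D\<^sub>0. graph_prob M A (UNIV, {e})) = q"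
    and bound: "\<And>D. D \<subseteq> E \<Longrightarrow> \<not> graph_connected (UNIV, D) \<Longrightarrow> (\<Sum>e\<in>D. graph_prob M A (UNIV, {e})) \<le> q"
  shows "p_max M A (gossip_graphs E) = q"
proof -
  let ?Pi = "max_disconnected_collections (gossip_graphs E)"
  have nonneg: "0 \<le> graph_prob M A G" for G by (simp add: graph_prob_def)
  have le: "collection_prob M A \<H> \<le> q" if H: "\<H> \<in> ?Pi" for \<H>
  proof -
    obtain D where "D \<subseteq> E" "\<H> = gossip_graphs D"
      using H subset_gossip_graphs by (auto simp: max_disconnected_collections_def)
    with H bound[of D] show ?thesis
      by (simp add: collection_prob_gossip_graphs max_disconnected_collections_def graph_union_gossip_graphs)
  qed
  have ge: "\<exists>\<H>\<in>?Pi. q \<le> collection_prob M A \<H>" if ne: "D\<^sub>0 \<noteq> {}"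
  proof -
    obtain D' where "D\<^sub>0 \<subseteq> D'" "gossip_graphs D' \<in> ?Pi"
      using disconnected_extends_to_maximal[OF attained(1) ne attained(2)] by auto
    moreover have "q \<le> collection_prob M A (gossip_graphs D')"
      unfolding collection_prob_gossip_graphs attained(3)[symmetric]
      using \<open>D\<^sub>0 \<subseteq> D'\<close> nonneg by (intro sum_mono2) auto
    ultimately show ?thesis by blast
  qed
  have fin: "finite ?Pi" by simp
  show ?thesis
  proof (cases "?Pi = {}")
    \<comment> \<open>Without maximal collections the optimal set \<open>D\<^sub>0\<close> must be
      empty, so \<open>q = 0\<close> agrees with the default value in \<open>p_max\<close>.\<close>
    case True
    with ge have "D\<^sub>0 = {}" by auto
    then have "q = 0" using attained(3) by simp
    with True show ?thesis by (simp add: p_max_def)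
  next
    case False
    have "Max (collection_prob M A ` ?Pi) = q"
    proof (rule antisym)
      show "Max (collection_prob M A ` ?Pi) \<le> q" using False fin le by auto
      have "\<exists>\<H>\<in>?Pi. q \<le> collection_prob M A \<H>"
      proof (cases "D\<^sub>0 = {}")
        \<comment> \<open>The empty set need not extend to a maximal collection, but then
          \<open>q = 0\<close> lies below the probability of any collection.\<close>
        case True
        then have "q = 0" using attained(3) by simp
        with False nonneg show ?thesis by (auto simp: collection_prob_def intro!: sum_nonneg)
      qed (rule ge)
      then show "q \<le> Max (collection_prob M A ` ?Pi)" using False fin by (auto simp: Max_ge_iff)
    qed
    with False show ?thesis by (simp add: p_max_def)
  qed
qed

section \<open>Moments of the deviation\<close>

text \<open>Split according to whether the active link lies in the set \<open>D\<close> of links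
  along which \<open>x\<close> varies little. If so, the deviation does not grow, and this has
  probability at most \<open>q\<close>; otherwise it shrinks by the factor
  \<open>1 - c\<close>.\<close>

lemma nn_integral_deviation_step:
  fixes A :: "'a \<Rightarrow> real ^ 'n ^ 'n" and x :: "real ^ 'n"
  assumes "prob_space M" and A: "A \<in> borel_measurable M"
    and ae: "AE \<omega> in M. sym_doubly_stochastic (A \<omega>) \<and> entries_bounded_below \<delta> (A \<omega>)
      \<and> induced_graph (A \<omega>) \<in> gossip_graphs E"
    and E: "E \<subseteq> {e. card e = 2}"
    and bound: "\<And>D. D \<subseteq> E \<Longrightarrow> \<not> graph_connected (UNIV, D) \<Longrightarrow>
      measure M {\<omega> \<in> space M. induced_graph (A \<omega>) \<in> gossip_graphs D} \<le> q"
    and \<delta>: "0 < \<delta>" and \<eta>: "0 < \<eta>" "\<eta> * real CARD('n) ^ 5 < 1"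
    and c: "c \<le> \<delta> * \<eta>" "c \<le> 1" and s: "0 < s"
  shows "(\<integral>\<^sup>+\<omega>. ennreal (deviation (A \<omega> *v x) ^ s) \<partial>M)
    \<le> ennreal ((q + (1 - c) ^ s) * deviation x ^ s)"
proof -
  interpret prob_space M by fact
  have shrink: "deviation (A \<omega> *v x) \<le> deviation x - \<delta> * (x $ i - x $ j)\<^sup>2"
    if "sym_doubly_stochastic (A \<omega>)" "entries_bounded_below \<delta> (A \<omega>)"
      "induced_graph (A \<omega>) = (UNIV, {{i, j}})" "{i, j} \<in> E" for \<omega> i j
  proof (rule gossip_matrix_deviation[OF that(1-3) _ \<delta>])
    show "i \<noteq> j" using that(4) E by auto
  qed
  have edge: "\<exists>i j. {i, j} \<in> E \<and> induced_graph (A \<omega>) = (UNIV, {{i, j}})"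
    if g: "induced_graph (A \<omega>) \<in> gossip_graphs E" for \<omega>
  proof -
    obtain e where e: "e \<in> E" "induced_graph (A \<omega>) = (UNIV, {e})"
      using g by (auto simp: gossip_graphs_def)
    then obtain i j where "e = {i, j}" using E by (auto simp: card_2_iff)
    with e show ?thesis by blast
  qed
  have le: "AE \<omega> in M. deviation (A \<omega> *v x) \<le> deviation x"
    using ae
  proof eventually_elim
    case (elim \<omega>)
    then obtain i j where "{i, j} \<in> E" "induced_graph (A \<omega>) = (UNIV, {{i, j}})"
      using edge by blast
    with elim have "deviation (A \<omega> *v x) \<le> deviation x - \<delta> * (x $ i - x $ j)\<^sup>2"
      by (intro shrink) auto
    moreover have "0 \<le> \<delta> * (x $ i - x $ j)\<^sup>2" using \<delta> by simp
    ultimately show ?case by linarith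
  qed
  show ?thesis
  proof (cases "deviation x = 0")
    \<comment> \<open>At consensus no link varies, so \<open>D\<close> as chosen in the other case
      need not be disconnected; instead the left side vanishes, as \<open>0 < s\<close>.\<close>
    case True
    have "(\<integral>\<^sup>+\<omega>. ennreal (deviation (A \<omega> *v x) ^ s) \<partial>M) = (\<integral>\<^sup>+\<omega>. 0 \<partial>M)"
    proof (rule nn_integral_cong_AE)
      show "AE \<omega> in M. ennreal (deviation (A \<omega> *v x) ^ s) = 0"
        using le
      proof eventually_elim
        case (elim \<omega>)
        with True deviation_nonneg[of "A \<omega> *v x"] have "deviation (A \<omega> *v x) = 0" by simp
        with s show ?case by simp
      qed
    qed
    then show ?thesis by simp
  next
    case False
    then have pos: "0 < deviation x" using deviation_nonneg[of x] by simp
    \<comment> \<open>\<open>D\<close> depends on \<open>x\<close>, but \<open>q\<close> bounds the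
      probability of every disconnected set, so the resulting factor is the same for all
      \<open>x\<close>.\<close>
    define D where "D = {e \<in> E. \<forall>i j. e = {i, j} \<longrightarrow> (x $ i - x $ j)\<^sup>2 \<le> \<eta> * deviation x}"
    define B where "B = {\<omega> \<in> space M. induced_graph (A \<omega>) \<in> gossip_graphs D}"
    have [measurable]: "B \<in> sets M"
      unfolding B_def by (rule measurable_induced_graph[OF A])
    have "D \<subseteq> E" by (auto simp: D_def)
    moreover have "\<not> graph_connected (UNIV, D)"
      by (rule small_increments_disconnected[OF pos \<eta>]) (auto simp: D_def)
    ultimately have "prob B \<le> q" unfolding B_def by (rule bound)
    \<comment> \<open>The second summand is kept on the whole space; this gives the simple factor
      \<open>q + (1 - c) ^ s\<close>, which still tends to \<open>q\<close> as \<open>s\<close>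
      grows.\<close>
    have "AE \<omega> in M. ennreal (deviation (A \<omega> *v x) ^ s)
        \<le> ennreal (deviation x ^ s) * indicator B \<omega> + ennreal ((1 - c) ^ s * deviation x ^ s)"
      using ae le AE_space
    proof eventually_elim
      case (elim \<omega>)
      show ?case
      proof (cases "\<omega> \<in> B")
        case True
        have "deviation (A \<omega> *v x) ^ s \<le> deviation x ^ s"
          using elim deviation_nonneg by (intro power_mono) auto
        then show ?thesis using True by (simp add: add_increasing2 ennreal_leI)
      next
        case False
        obtain i j where ij: "{i, j} \<in> E" "induced_graph (A \<omega>) = (UNIV, {{i, j}})"
          using edge elim by blast
        have "{i, j} \<notin> D"
          using False elim ij(2) by (auto simp: B_def gossip_graphs_def)
        with ij(1) obtain i' j' where ij': "{i, j} = {i', j'}" "\<eta> * deviation x < (x $ i' - x $ j')\<^sup>2"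
          by (auto simp: D_def not_le)
        with ij elim have "deviation (A \<omega> *v x) \<le> deviation x - \<delta> * (x $ i' - x $ j')\<^sup>2"
          by (intro shrink) auto
        also have "\<dots> \<le> deviation x - \<delta> * (\<eta> * deviation x)"
          using ij'(2) \<delta> by simp
        also have "\<dots> \<le> (1 - c) * deviation x"
          using mult_right_mono[OF c(1), of "deviation x"] pos by (simp add: algebra_simps)
        finally have "deviation (A \<omega> *v x) ^ s \<le> ((1 - c) * deviation x) ^ s"
          using deviation_nonneg by (intro power_mono) auto
        then show ?thesis using False by (simp add: power_mult_distrib ennreal_leI)
      qed
    qed
    then have "(\<integral>\<^sup>+\<omega>. ennreal (deviation (A \<omega> *v x) ^ s) \<partial>M)
        \<le> (\<integral>\<^sup>+\<omega>. ennreal (deviation x ^ s) * indicator B \<omega> + ennreal ((1 - c) ^ s * deviation x ^ s) \<partial>M)"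
      by (rule nn_integral_mono_AE)
    also have "\<dots> = ennreal (deviation x ^ s) * emeasure M B + ennreal ((1 - c) ^ s * deviation x ^ s)"
      by (subst nn_integral_add) (auto simp: nn_integral_cmult_indicator emeasure_space_1)
    also have "\<dots> = ennreal (deviation x ^ s * prob B + (1 - c) ^ s * deviation x ^ s)"
      using c pos by (simp add: emeasure_eq_measure ennreal_mult' ennreal_plus)
    also have "\<dots> \<le> ennreal ((q + (1 - c) ^ s) * deviation x ^ s)"
      using \<open>prob B \<le> q\<close> mult_right_mono[OF \<open>prob B \<le> q\<close>, of "deviation x ^ s"] pos
      by (intro ennreal_leI) (simp add: algebra_simps)
    finally show ?thesis .
  qed
qed

text \<open>The joint law of independent variables is the product law, so Tonelli integrates over
  \<open>Y\<close> with \<open>X\<close> frozen. This stands in for conditioning on the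
  past.\<close>

lemma (in prob_space) nn_integral_indep_var:
  assumes ind: "indep_var S X T Y" and f: "f \<in> borel_measurable (S \<Otimes>\<^sub>M T)"
  shows "(\<integral>\<^sup>+\<omega>. f (X \<omega>, Y \<omega>) \<partial>M) = (\<integral>\<^sup>+\<omega>'. \<integral>\<^sup>+\<omega>. f (X \<omega>', Y \<omega>) \<partial>M \<partial>M)"
proof -
  have X: "random_variable S X" and Y: "random_variable T Y"
    and eq: "distr M S X \<Otimes>\<^sub>M distr M T Y = distr M (S \<Otimes>\<^sub>M T) (\<lambda>x. (X x, Y x))"
    using ind by (auto simp: indep_var_distribution_eq)
  interpret Y: prob_space "distr M T Y" by (rule prob_space_distr[OF Y])
  have f': "f \<in> borel_measurable (distr M S X \<Otimes>\<^sub>M distr M T Y)"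
    using f by (simp cong: measurable_cong_sets)
  have "(\<integral>\<^sup>+\<omega>. f (X \<omega>, Y \<omega>) \<partial>M) = integral\<^sup>N (distr M S X \<Otimes>\<^sub>M distr M T Y) f"
    unfolding eq using X Y f by (subst nn_integral_distr) auto
  also have "\<dots> = (\<integral>\<^sup>+x. \<integral>\<^sup>+y. f (x, y) \<partial>distr M T Y \<partial>distr M S X)"
    by (rule Y.nn_integral_fst[OF f', symmetric])
  also have "\<dots> = (\<integral>\<^sup>+\<omega>'. \<integral>\<^sup>+y. f (X \<omega>', y) \<partial>distr M T Y \<partial>M)"
    using Y.borel_measurable_nn_integral_fst[OF f'] X by (subst nn_integral_distr) auto
  also have "\<dots> = (\<integral>\<^sup>+\<omega>'. \<integral>\<^sup>+\<omega>. f (X \<omega>', Y \<omega>) \<partial>M \<partial>M)"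
  proof (rule nn_integral_cong)
    fix \<omega>' assume "\<omega>' \<in> space M"
    then have "X \<omega>' \<in> space S" using X by (rule measurable_space[rotated])
    then have "(\<lambda>y. f (X \<omega>', y)) \<in> borel_measurable T"
      using f by measurable
    then show "(\<integral>\<^sup>+y. f (X \<omega>', y) \<partial>distr M T Y) = (\<integral>\<^sup>+\<omega>. f (X \<omega>', Y \<omega>) \<partial>M)"
      using Y by (subst nn_integral_distr) auto
  qed
  finally show ?thesis .
qed

section \<open>Random matrix products: measurability, independence, iteration\<close>

lemma borel_measurable_matrix_vector_mult:
  fixes F :: "'a \<Rightarrow> real ^ 'n ^ 'm" and x :: "'a \<Rightarrow> real ^ 'n"
  assumes "F \<in> borel_measurable M" "x \<in> borel_measurable M"
  shows "(\<lambda>\<omega>. F \<omega> *v x \<omega>) \<in> borel_measurable M"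
  by (rule borel_measurable_continuous_Pair[OF assms])
    (unfold matrix_vector_mult_def, intro continuous_intros)

lemma borel_measurable_matrix_matrix_mult:
  fixes F :: "'a \<Rightarrow> real ^ 'n ^ 'm" and G :: "'a \<Rightarrow> real ^ 'k ^ 'n"
  assumes "F \<in> borel_measurable M" "G \<in> borel_measurable M"
  shows "(\<lambda>\<omega>. F \<omega> ** G \<omega>) \<in> borel_measurable M"
  by (rule borel_measurable_continuous_Pair[OF assms])
    (unfold matrix_matrix_mult_def, intro continuous_intros)

lemma borel_measurable_deviation:
  fixes x :: "'a \<Rightarrow> real ^ 'n"
  assumes "x \<in> borel_measurable M"
  shows "(\<lambda>\<omega>. deviation (x \<omega>)) \<in> borel_measurable M"
  by (rule borel_measurable_continuous_on[OF _ assms])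
    (unfold deviation_def, intro continuous_intros, simp)

lemma borel_measurable_matrix_product:
  fixes W :: "nat \<Rightarrow> 'a \<Rightarrow> real ^ 'n ^ 'n"
  assumes "\<And>m. 1 \<le> m \<Longrightarrow> m \<le> k \<Longrightarrow> W m \<in> borel_measurable M"
  shows "matrix_product W k \<in> borel_measurable M"
  using assms
proof (induction k)
  case 0
  have "matrix_product W 0 = (\<lambda>\<omega>. mat 1)" by (simp add: fun_eq_iff)
  then show ?case by simp
next
  case (Suc k)
  have "matrix_product W (Suc k) = (\<lambda>\<omega>. W (Suc k) \<omega> ** matrix_product W k \<omega>)"
    by (simp add: fun_eq_iff)
  moreover have "\<dots> \<in> borel_measurable M"
    using Suc by (intro borel_measurable_matrix_matrix_mult) auto
  ultimately show ?case by simp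
qed

text \<open>Feeding the coordinate maps \<open>\<lambda>m f. f m\<close> to
  \<open>matrix_product\<close> turns it into a function of the tuple of matrices, which exhibits
  the product as depending on the first \<open>k\<close> only.\<close>

lemma matrix_product_restrict:
  "K \<supseteq> {1..k} \<Longrightarrow> matrix_product (\<lambda>m f. f m) k (restrict (\<lambda>m. W m \<omega>) K) = matrix_product W k \<omega>"
  by (induction k) (auto simp: subset_iff)

lemma (in prob_space) indep_var_matrix_product:
  fixes W :: "nat \<Rightarrow> 'a \<Rightarrow> real ^ 'n ^ 'n"
  assumes "indep_vars (\<lambda>_. borel) W {1..}"
  shows "indep_var borel (matrix_product W k) borel (W (Suc k))"
proof -
  have "indep_var (PiM {1..k} (\<lambda>_. borel)) (\<lambda>\<omega>. restrict (\<lambda>m. W m \<omega>) {1..k})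
      (PiM {Suc k} (\<lambda>_. borel)) (\<lambda>\<omega>. restrict (\<lambda>m. W m \<omega>) {Suc k})"
    by (rule indep_var_restrict[OF assms]) auto
  then have "indep_var borel (matrix_product (\<lambda>m f. f m) k \<circ> (\<lambda>\<omega>. restrict (\<lambda>m. W m \<omega>) {1..k}))
      borel ((\<lambda>f. f (Suc k)) \<circ> (\<lambda>\<omega>. restrict (\<lambda>m. W m \<omega>) {Suc k}))"
    by (rule indep_var_compose)
      (auto intro!: borel_measurable_matrix_product measurable_component_singleton)
  then show ?thesis by (simp add: comp_def matrix_product_restrict)
qed

text \<open>Induction on \<open>k\<close>: the newest factor is independent of the earlier product,
  and the one-step bound holds for every starting vector.\<close>

lemma nn_integral_deviation_matrix_product:
  fixes W :: "nat \<Rightarrow> 'a \<Rightarrow> real ^ 'n ^ 'n" and x :: "real ^ 'n"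
  assumes "prob_space M" and ind: "prob_space.indep_vars M (\<lambda>_. borel) W {1..}"
    and step: "\<And>m x. 1 \<le> m \<Longrightarrow> (\<integral>\<^sup>+\<omega>. ennreal (deviation (W m \<omega> *v x) ^ s) \<partial>M)
      \<le> ennreal (r * deviation x ^ s)"
    and r: "0 \<le> r"
  shows "(\<integral>\<^sup>+\<omega>. ennreal (deviation (matrix_product W k \<omega> *v x) ^ s) \<partial>M)
    \<le> ennreal (r ^ k * deviation x ^ s)"
proof -
  interpret prob_space M by fact
  have W: "W m \<in> borel_measurable M" if "1 \<le> m" for m
    using ind that by (auto simp: indep_vars_def)
  show ?thesis
  proof (induction k)
    case 0
    then show ?case by (simp add: emeasure_space_1)
  next
    case (Suc k)
    let ?f = "\<lambda>(F, w). ennreal (deviation (w *v (F *v x)) ^ s)"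
    have f: "?f \<in> borel_measurable (borel \<Otimes>\<^sub>M borel)"
      unfolding split_beta
      by (intro measurable_compose[OF _ measurable_ennreal] borel_measurable_power
          borel_measurable_deviation borel_measurable_matrix_vector_mult) simp_all
    have "(\<integral>\<^sup>+\<omega>. ennreal (deviation (matrix_product W (Suc k) \<omega> *v x) ^ s) \<partial>M)
        = (\<integral>\<^sup>+\<omega>. ?f (matrix_product W k \<omega>, W (Suc k) \<omega>) \<partial>M)"
      by (simp add: matrix_vector_mul_assoc)
    also have "\<dots> = (\<integral>\<^sup>+\<omega>'. \<integral>\<^sup>+\<omega>. ?f (matrix_product W k \<omega>', W (Suc k) \<omega>) \<partial>M \<partial>M)"
      by (rule nn_integral_indep_var[OF indep_var_matrix_product[OF ind] f])
    also have "\<dots> \<le> (\<integral>\<^sup>+\<omega>'. ennreal r * ennreal (deviation (matrix_product W k \<omega>' *v x) ^ s) \<partial>M)"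
      using step[of "Suc k"] r by (intro nn_integral_mono) (simp add: ennreal_mult')
    also have "\<dots> = ennreal r * (\<integral>\<^sup>+\<omega>'. ennreal (deviation (matrix_product W k \<omega>' *v x) ^ s) \<partial>M)"
      using W by (intro nn_integral_cmult measurable_compose[OF _ measurable_ennreal]
          borel_measurable_power borel_measurable_deviation borel_measurable_matrix_vector_mult
          borel_measurable_matrix_product) auto
    also have "\<dots> \<le> ennreal r * ennreal (r ^ k * deviation x ^ s)"
      by (intro mult_left_mono Suc.IH) simp
    also have "\<dots> = ennreal (r ^ Suc k * deviation x ^ s)"
      using r by (simp add: ennreal_mult'[symmetric] mult.assoc)
    finally show ?case .
  qed
qed

section \<open>The rate of consensus\<close>

text \<open>Expanding \<open>x\<close> in the standard basis gives a crude bound that reduces the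
  norm to finitely many test vectors.\<close>

lemma spectral_norm_le_sum_columns:
  fixes A :: "real ^ 'n ^ 'n"
  shows "spectral_norm A \<le> (\<Sum>i\<in>UNIV. norm (A *v axis i 1))"
  unfolding spectral_norm_def
proof (rule onorm_le)
  fix x :: "real ^ 'n"
  have "A *v x = (\<Sum>i\<in>UNIV. x $ i *\<^sub>R (A *v axis i 1))"
    unfolding matrix_vector_mult_basis by (simp add: matrix_mult_sum scalar_mult_eq_scaleR)
  also have "norm \<dots> \<le> (\<Sum>i\<in>UNIV. norm (x $ i *\<^sub>R (A *v axis i 1)))"
    by (rule norm_sum)
  also have "\<dots> \<le> (\<Sum>i\<in>UNIV. norm x * norm (A *v axis i 1))"
    by (intro sum_mono) (simp add: mult_right_mono component_le_norm_cart)
  finally show "norm (A *v x) \<le> (\<Sum>i\<in>UNIV. norm (A *v axis i 1)) * norm x"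
    by (simp add: sum_distrib_left mult.commute)
qed

text \<open>By the triangle inequality two norms differ by at most the norm of the difference, hence
  by a sum of column norms that is continuous and vanishes at \<open>A\<close>. It serves to make
  the no-consensus events measurable.\<close>

lemma continuous_on_spectral_norm:
  "continuous_on S (spectral_norm :: real ^ 'n ^ 'n \<Rightarrow> real)"
proof -
  have le: "spectral_norm A \<le> spectral_norm B + (\<Sum>i\<in>UNIV. norm ((A - B) *v axis i 1))"
    for A B :: "real ^ 'n ^ 'n"
  proof -
    have "spectral_norm A = onorm (\<lambda>x. B *v x + (A - B) *v x)"
      by (simp add: spectral_norm_def matrix_vector_mult_diff_rdistrib)
    also have "\<dots> \<le> spectral_norm B + spectral_norm (A - B)"
      unfolding spectral_norm_def by (rule onorm_triangle) auto
    finally show ?thesis using spectral_norm_le_sum_columns[of "A - B"] by simp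
  qed
  have "(spectral_norm \<longlongrightarrow> spectral_norm A) (at A within S)" for A :: "real ^ 'n ^ 'n"
  proof (rule Lim_null[THEN iffD2], rule Lim_null_comparison)
    have "norm ((B - A) *v x) = norm ((A - B) *v x)" for B x
      by (simp add: matrix_vector_mult_diff_rdistrib norm_minus_commute)
    then have "\<bar>spectral_norm B - spectral_norm A\<bar> \<le> (\<Sum>i\<in>UNIV. norm ((B - A) *v axis i 1))" for B
      using le[of A B] le[of B A] by (simp add: abs_le_iff)
    then show "\<forall>\<^sub>F B in at A within S.
        norm (spectral_norm B - spectral_norm A) \<le> (\<Sum>i\<in>UNIV. norm ((B - A) *v axis i 1))"
      by simp
    have "continuous_on UNIV (\<lambda>B. \<Sum>i\<in>UNIV. norm ((B - A) *v axis i 1))"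
      unfolding matrix_vector_mult_def by (intro continuous_intros)
    then have "((\<lambda>B. \<Sum>i\<in>UNIV. norm ((B - A) *v axis i 1)) \<longlongrightarrow> (\<Sum>i\<in>UNIV. norm ((A - A) *v axis i 1)))
        (at A within S)"
      unfolding continuous_on_def by (meson UNIV_I subset_UNIV tendsto_within_subset)
    then show "((\<lambda>B. \<Sum>i\<in>UNIV. norm ((B - A) *v axis i 1)) \<longlongrightarrow> 0) (at A within S)"
      by simp
  qed
  then show ?thesis by (simp add: continuous_on_def)
qed

section \<open>Distance to the averaging matrix\<close>

lemma averaging_matrix_mult:
  "averaging_matrix *v x = (\<chi> i. (\<Sum>j\<in>UNIV. x $ j) / real CARD('n))" for x :: "real ^ 'n"
  by (simp add: averaging_matrix_def matrix_vector_mult_def vec_eq_iff flip: sum_divide_distrib)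

lemma sum_doubly_stochastic_mult:
  fixes w :: "real ^ 'n ^ 'n"
  assumes "sym_doubly_stochastic w"
  shows "(\<Sum>i\<in>UNIV. (w *v x) $ i) = (\<Sum>i\<in>UNIV. x $ i)"
proof -
  have "(\<Sum>i\<in>UNIV. (w *v x) $ i) = (\<Sum>j\<in>UNIV. \<Sum>i\<in>UNIV. w $ i $ j * x $ j)"
    by (simp add: matrix_vector_mult_def) (rule sum.swap)
  also have "\<dots> = (\<Sum>j\<in>UNIV. x $ j)"
    using assms by (simp add: sym_doubly_stochastic_def flip: sum_distrib_right)
  finally show ?thesis .
qed

lemma sum_matrix_product_mult:
  fixes W :: "nat \<Rightarrow> 'a \<Rightarrow> real ^ 'n ^ 'n"
  assumes "\<And>m. 1 \<le> m \<Longrightarrow> m \<le> k \<Longrightarrow> sym_doubly_stochastic (W m \<omega>)"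
  shows "(\<Sum>i\<in>UNIV. (matrix_product W k \<omega> *v x) $ i) = (\<Sum>i\<in>UNIV. x $ i)"
  using assms
proof (induction k)
  case (Suc k)
  then show ?case
    by (simp add: sum_doubly_stochastic_mult flip: matrix_vector_mul_assoc)
qed simp

text \<open>As \<open>F\<close> preserves sums, subtracting \<open>averaging_matrix *v x\<close>
  from \<open>F *v x\<close> centres the latter, so the norm of what remains is the root of the
  deviation.\<close>

lemma spectral_norm_le_sum_deviation:
  fixes F :: "real ^ 'n ^ 'n"
  assumes "\<And>x. (\<Sum>i\<in>UNIV. (F *v x) $ i) = (\<Sum>i\<in>UNIV. x $ i)"
  shows "spectral_norm (F - averaging_matrix) \<le> (\<Sum>i\<in>UNIV. sqrt (deviation (F *v axis i 1)))"
proof -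
  have "norm ((F - averaging_matrix) *v x) = sqrt (deviation (F *v x))" for x
    by (simp add: matrix_vector_mult_diff_rdistrib averaging_matrix_mult deviation_eq_norm assms)
  then show ?thesis
    using spectral_norm_le_sum_columns[of "F - averaging_matrix"] by simp
qed

text \<open>The averaging matrix kills zero-sum vectors, so \<open>x\<close> is an eigenvector of
  the difference with eigenvalue 1.\<close>

lemma spectral_norm_ge_1:
  fixes F :: "real ^ 'n ^ 'n"
  assumes "F *v x = x" "(\<Sum>i\<in>UNIV. x $ i) = 0" "x \<noteq> 0"
  shows "1 \<le> spectral_norm (F - averaging_matrix)"
proof -
  have "(F - averaging_matrix) *v x = x"
    using assms(1,2) by (simp add: matrix_vector_mult_diff_rdistrib averaging_matrix_mult vec_eq_iff)
  moreover have "norm ((F - averaging_matrix) *v x) \<le> spectral_norm (F - averaging_matrix) * norm x"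
    unfolding spectral_norm_def by (rule onorm) auto
  ultimately show ?thesis using assms(3) by simp
qed

lemma disconnected_invariant_vector:
  fixes D :: "'n::finite set set"
  assumes "\<not> graph_connected (UNIV, D)"
  obtains x :: "real ^ 'n" where "x \<noteq> 0" "(\<Sum>i\<in>UNIV. x $ i) = 0" "\<And>i j. {i, j} \<in> D \<Longrightarrow> x $ i = x $ j"
proof -
  let ?R = "{(x, y). {x, y} \<in> D}"
  obtain u v where uv: "(u, v) \<notin> ?R\<^sup>*"
    using assms by (auto simp: graph_connected_UNIV)
  \<comment> \<open>\<open>S\<close> is the component of \<open>u\<close>. It omits
    \<open>v\<close>, so its centred indicator differs at \<open>u\<close> and \<open>v\<close> and
    is nonzero.\<close>
  define S where "S = {i. (u, i) \<in> ?R\<^sup>*}"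
  define x :: "real ^ 'n" where "x = (\<chi> i. indicat_real S i - real (card S) / real CARD('n))"
  have "x $ u \<noteq> x $ v" using uv by (simp add: x_def S_def)
  then have "x \<noteq> 0" by auto
  moreover have "(\<Sum>i\<in>UNIV. x $ i) = 0"
    by (simp add: x_def sum_subtractf indicator_def sum.If_cases)
  moreover have "x $ i = x $ j" if "{i, j} \<in> D" for i j
  proof -
    have "(i, j) \<in> ?R" "(j, i) \<in> ?R" using that by (simp_all add: insert_commute)
    then have "i \<in> S \<longleftrightarrow> j \<in> S"
      unfolding S_def by (blast intro: rtrancl.rtrancl_into_rtrancl)
    then show ?thesis by (simp add: x_def indicator_def)
  qed
  ultimately show ?thesis by (rule that)
qed

section \<open>Two-sided bounds on the probability of no consensus\<close>

lemma matrix_product_fixes: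
  assumes "\<And>m. 1 \<le> m \<Longrightarrow> m \<le> k \<Longrightarrow> W m \<omega> *v x = x"
  shows "matrix_product W k \<omega> *v x = x"
  using assms by (induction k) (auto simp flip: matrix_vector_mul_assoc)

lemma (in prob_space) prob_indep_vars_all:
  assumes "indep_vars (\<lambda>_. N) X {1::nat..}" "S \<in> sets N" "1 \<le> k"
    and "\<And>m. 1 \<le> m \<Longrightarrow> prob {\<omega> \<in> space M. X m \<omega> \<in> S} = p"
  shows "prob {\<omega> \<in> space M. \<forall>m\<in>{1..k}. X m \<omega> \<in> S} = p ^ k"
proof -
  have "prob (\<Inter>m\<in>{1..k}. X m -` S \<inter> space M) = (\<Prod>m\<in>{1..k}. prob (X m -` S \<inter> space M))"
    using assms by (intro indep_varsD[OF assms(1)]) auto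
  also have "\<dots> = (\<Prod>m\<in>{1..k}. p)"
  proof (rule prod.cong[OF refl])
    fix m assume "m \<in> {1..k}"
    have "X m -` S \<inter> space M = {\<omega> \<in> space M. X m \<omega> \<in> S}" by auto
    then show "prob (X m -` S \<inter> space M) = p" using assms(4)[of m] \<open>m \<in> {1..k}\<close> by simp
  qed
  \<comment> \<open>For \<open>k = 0\<close> the intersection would be the whole type rather than
    \<open>space M\<close>.\<close>
  also have "(\<Inter>m\<in>{1..k}. X m -` S \<inter> space M) = {\<omega> \<in> space M. \<forall>m\<in>{1..k}. X m \<omega> \<in> S}"
    using \<open>1 \<le> k\<close> by force
  finally show ?thesis by simp
qed

text \<open>If the first \<open>k\<close> active links all lie in \<open>D\<close>, a nonzero
  zero-sum vector constant along \<open>D\<close> is fixed by every factor, so the norm is at least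
  1. Independence gives this event probability \<open>p ^ k\<close>.\<close>

lemma prob_no_consensus_ge:
  fixes W :: "nat \<Rightarrow> 'a \<Rightarrow> real ^ 'n ^ 'n"
  assumes gossip: "gossip_model M W \<delta> E"
    and D: "D \<subseteq> E" "\<not> graph_connected (UNIV, D)"
    and p: "\<And>m. 1 \<le> m \<Longrightarrow> measure M {\<omega> \<in> space M. induced_graph (W m \<omega>) \<in> gossip_graphs D} = p"
    and k: "1 \<le> k" and \<epsilon>: "\<epsilon> \<le> 1"
  shows "p ^ k \<le> measure M {\<omega> \<in> space M.
    spectral_norm (matrix_product W k \<omega> - averaging_matrix) \<ge> \<epsilon>}"
proof -
  interpret prob_space M
    using gossip by (simp add: gossip_model_def matrix_process_def iid_matrices_def)
  have ind: "indep_vars (\<lambda>_. borel) W {1..}"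
    and ds: "\<And>m. 1 \<le> m \<Longrightarrow> AE \<omega> in M. sym_doubly_stochastic (W m \<omega>)"
    and E: "E \<subseteq> {e. card e = 2}"
    using gossip by (auto simp: gossip_model_def matrix_process_def iid_matrices_def)
  have W: "W m \<in> borel_measurable M" if "1 \<le> m" for m
    using ind that by (auto simp: indep_vars_def)
  obtain x :: "real ^ 'n" where x: "x \<noteq> 0" "(\<Sum>i\<in>UNIV. x $ i) = 0"
    and inv: "\<And>i j. {i, j} \<in> D \<Longrightarrow> x $ i = x $ j"
    using disconnected_invariant_vector[OF D(2)] by blast
  define B where "B = {\<omega> \<in> space M. \<forall>m\<in>{1..k}. induced_graph (W m \<omega>) \<in> gossip_graphs D}"
  have B: "p ^ k = prob B"
    using prob_indep_vars_all[OF ind measurable_induced_graph_borel k, of "gossip_graphs D" p] p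
    by (simp add: B_def)
  have fix1: "w *v x = x" if w: "sym_doubly_stochastic w" "induced_graph w \<in> gossip_graphs D" for w
  proof -
    obtain e where e: "e \<in> D" "induced_graph w = (UNIV, {e})"
      using w(2) by (auto simp: gossip_graphs_def)
    then obtain i j where "e = {i, j}" "i \<noteq> j" using D(1) E by (auto simp: card_2_iff)
    with e w(1) inv show ?thesis by (intro gossip_matrix_fixes[of _ i j]) auto
  qed
  have "AE \<omega> in M. \<forall>m\<in>{1..k}. sym_doubly_stochastic (W m \<omega>)"
    by (intro AE_finite_allI ds) auto
  then have "AE \<omega> in M. \<omega> \<in> B \<longrightarrow>
      \<omega> \<in> {\<omega> \<in> space M. spectral_norm (matrix_product W k \<omega> - averaging_matrix) \<ge> \<epsilon>}"
  proof eventually_elim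
    case (elim \<omega>)
    show ?case
    proof
      assume "\<omega> \<in> B"
      then have "matrix_product W k \<omega> *v x = x"
        using elim by (intro matrix_product_fixes fix1) (auto simp: B_def)
      from spectral_norm_ge_1[OF this x(2,1)] \<epsilon> \<open>\<omega> \<in> B\<close>
      show "\<omega> \<in> {\<omega> \<in> space M. spectral_norm (matrix_product W k \<omega> - averaging_matrix) \<ge> \<epsilon>}"
        by (simp add: B_def)
    qed
  qed
  moreover have "(\<lambda>\<omega>. spectral_norm (matrix_product W k \<omega> - averaging_matrix)) \<in> borel_measurable M"
    using W by (intro borel_measurable_continuous_on[OF continuous_on_spectral_norm]
        borel_measurable_diff borel_measurable_matrix_product) auto
  then have "{\<omega> \<in> space M. spectral_norm (matrix_product W k \<omega> - averaging_matrix) \<ge> \<epsilon>} \<in> sets M"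
    by measurable
  ultimately show ?thesis
    unfolding B by (rule finite_measure_mono_AE)
qed

text \<open>A large norm forces a large deviation for some basis vector; Markov's inequality for the
  \<open>s\<close>-th moment and a union bound over the basis finish.\<close>

lemma prob_no_consensus_le:
  fixes W :: "nat \<Rightarrow> 'a \<Rightarrow> real ^ 'n ^ 'n"
  assumes gossip: "gossip_model M W \<delta> E"
    and moment: "\<And>x. (\<integral>\<^sup>+\<omega>. ennreal (deviation (matrix_product W k \<omega> *v x) ^ s) \<partial>M)
      \<le> ennreal (r * deviation x ^ s)"
    and r: "0 \<le> r" and \<epsilon>: "0 < \<epsilon>"
  shows "measure M {\<omega> \<in> space M. spectral_norm (matrix_product W k \<omega> - averaging_matrix) \<ge> \<epsilon>}
    \<le> real CARD('n) * ((real CARD('n) / \<epsilon>)\<^sup>2) ^ s * r"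
proof -
  interpret prob_space M
    using gossip by (simp add: gossip_model_def matrix_process_def iid_matrices_def)
  have ind: "indep_vars (\<lambda>_. borel) W {1..}"
    and ds: "\<And>m. 1 \<le> m \<Longrightarrow> AE \<omega> in M. sym_doubly_stochastic (W m \<omega>)"
    using gossip by (auto simp: gossip_model_def matrix_process_def iid_matrices_def)
  have W: "W m \<in> borel_measurable M" if "1 \<le> m" for m
    using ind that by (auto simp: indep_vars_def)
  \<comment> \<open>With all deviations below \<open>a\<close>, the N square roots sum to less than
    N (\<epsilon> / N) = \<epsilon>.\<close>
  define a where "a = (\<epsilon> / real CARD('n))\<^sup>2"
  have a: "0 < a" using \<epsilon> by (simp add: a_def)
  define V where "V i \<omega> = deviation (matrix_product W k \<omega> *v axis i 1)" for i \<omega>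
  have [measurable]: "V i \<in> borel_measurable M" for i
    unfolding V_def using W
    by (intro borel_measurable_deviation borel_measurable_matrix_vector_mult
        borel_measurable_matrix_product) auto
  have tail: "prob {\<omega> \<in> space M. a \<le> V i \<omega>} \<le> (1 / a) ^ s * r" for i
  proof -
    let ?A = "{\<omega> \<in> space M. a \<le> V i \<omega>}"
    have "ennreal (a ^ s) * emeasure M ?A = (\<integral>\<^sup>+\<omega>. ennreal (a ^ s) * indicator ?A \<omega> \<partial>M)"
      by (simp add: nn_integral_cmult_indicator)
    also have "\<dots> \<le> (\<integral>\<^sup>+\<omega>. ennreal (V i \<omega> ^ s) \<partial>M)"
      using a by (intro nn_integral_mono) (auto simp: indicator_def intro!: ennreal_leI power_mono)
    also have "\<dots> \<le> ennreal (r * deviation (axis i 1 :: real ^ 'n) ^ s)"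
      unfolding V_def by (rule moment)
    \<comment> \<open>A basis vector has deviation 1 - 1/N, at most 1, so the initial deviation
      disappears from the bound.\<close>
    also have "\<dots> \<le> ennreal r"
    proof (intro ennreal_leI mult_right_le_one_le[THEN order_trans] power_le_one deviation_nonneg)
      show "deviation (axis i 1 :: real ^ 'n) \<le> 1"
        by (simp add: deviation_def inner_axis_axis)
    qed (use r in \<open>auto intro: zero_le_power deviation_nonneg\<close>)
    finally have "ennreal (a ^ s * prob ?A) \<le> ennreal r"
      using a by (simp add: emeasure_eq_measure ennreal_mult')
    then have "a ^ s * prob ?A \<le> r" using r by simp
    then show ?thesis using a by (simp add: power_divide field_simps)
  qed
  have "AE \<omega> in M. \<forall>m\<in>{1..k}. sym_doubly_stochastic (W m \<omega>)"
    by (intro AE_finite_allI ds) auto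
  then have "AE \<omega> in M.
      \<omega> \<in> {\<omega> \<in> space M. spectral_norm (matrix_product W k \<omega> - averaging_matrix) \<ge> \<epsilon>} \<longrightarrow>
      \<omega> \<in> (\<Union>i\<in>UNIV. {\<omega> \<in> space M. a \<le> V i \<omega>})"
  proof eventually_elim
    case (elim \<omega>)
    show ?case
    proof (rule impI, rule ccontr)
      assume \<omega>: "\<omega> \<in> {\<omega> \<in> space M. spectral_norm (matrix_product W k \<omega> - averaging_matrix) \<ge> \<epsilon>}"
        and "\<omega> \<notin> (\<Union>i\<in>UNIV. {\<omega> \<in> space M. a \<le> V i \<omega>})"
      then have "V i \<omega> < a" for i by (auto simp: not_le)
      then have "sqrt (V i \<omega>) < \<epsilon> / real CARD('n)" for i
        using real_sqrt_less_mono[of "V i \<omega>" a] \<epsilon> by (simp add: a_def)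
      then have "(\<Sum>i\<in>UNIV. sqrt (V i \<omega>)) < (\<Sum>i\<in>(UNIV::'n set). \<epsilon> / real CARD('n))"
        by (intro sum_strict_mono) auto
      moreover have "spectral_norm (matrix_product W k \<omega> - averaging_matrix) \<le> (\<Sum>i\<in>UNIV. sqrt (V i \<omega>))"
        unfolding V_def using elim
        by (intro spectral_norm_le_sum_deviation sum_matrix_product_mult) auto
      ultimately show False using \<omega> by simp
    qed
  qed
  then have "measure M {\<omega> \<in> space M. spectral_norm (matrix_product W k \<omega> - averaging_matrix) \<ge> \<epsilon>}
      \<le> prob (\<Union>i\<in>UNIV. {\<omega> \<in> space M. a \<le> V i \<omega>})"
    by (intro finite_measure_mono_AE) auto
  also have "\<dots> \<le> (\<Sum>i\<in>UNIV. prob {\<omega> \<in> space M. a \<le> V i \<omega>})"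
    by (intro finite_measure_subadditive_finite) auto
  also have "\<dots> \<le> (\<Sum>i\<in>(UNIV::'n set). (1 / a) ^ s * r)"
    by (intro sum_mono tail)
  also have "\<dots> = real CARD('n) * ((real CARD('n) / \<epsilon>)\<^sup>2) ^ s * r"
    by (simp add: a_def power_divide)
  finally show ?thesis .
qed

section \<open>Logarithmic asymptotics and conclusion\<close>

lemma elog_mono: "x \<le> y \<Longrightarrow> elog x \<le> elog y"
  by (auto simp: elog_def)

lemma scaled_elog_power:
  assumes "1 \<le> k" "0 \<le> q"
  shows "ereal (1 / real k) * elog (q ^ k) = elog q"
  using assms by (cases "q = 0") (auto simp: elog_def ln_realpow not_le zero_power)

text \<open>The lower bound gives \<open>elog q\<close> at every \<open>k\<close>. For each fixed
  \<open>s\<close> the upper bound limits the exponent to ln (q + b^s), as the prefactor is lost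
  after division by \<open>k\<close>; only then is \<open>s\<close> made large.\<close>

lemma tendsto_elog_exponential_bounds:
  fixes u :: "nat \<Rightarrow> real" and q b :: real and C :: "nat \<Rightarrow> real"
  assumes q: "0 \<le> q" and b: "0 < b" "b < 1"
    and lower: "\<And>k. 1 \<le> k \<Longrightarrow> q ^ k \<le> u k"
    and upper: "\<And>s k. 0 < s \<Longrightarrow> 1 \<le> k \<Longrightarrow> u k \<le> C s * (q + b ^ s) ^ k"
    and C: "\<And>s. 0 < s \<Longrightarrow> 0 < C s"
  shows "(\<lambda>k. ereal (1 / real k) * elog (u k)) \<longlonglongrightarrow> elog q"
proof (rule order_tendstoI)
  fix a assume a: "a < elog q"
  have "\<forall>\<^sub>F k in sequentially. elog q \<le> ereal (1 / real k) * elog (u k)"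
    using eventually_ge_at_top[of 1]
  proof eventually_elim
    case (elim k)
    have "ereal (1 / real k) * elog (q ^ k) \<le> ereal (1 / real k) * elog (u k)"
      by (rule ereal_mult_left_mono[OF elog_mono[OF lower[OF elim]]]) simp
    with elim q show ?case by (simp add: scaled_elog_power)
  qed
  then show "\<forall>\<^sub>F k in sequentially. a < ereal (1 / real k) * elog (u k)"
    by eventually_elim (use a in \<open>rule less_le_trans\<close>)
next
  fix a assume a: "elog q < a"
  have pow: "(\<lambda>s. q + b ^ s) \<longlonglongrightarrow> q"
    using b by (auto intro!: tendsto_eq_intros LIMSEQ_power_zero)
  have "\<exists>y. elog q < ereal y \<and> ereal y < a"
    using ereal_dense2[OF a] .
  \<comment> \<open>A real number in between also serves when \<open>q = 0\<close>, where
    \<open>elog q\<close> is -\<infinity>.\<close>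
  then obtain y where y: "elog q < ereal y" "ereal y < a" by blast
  have "q < exp y"
  proof (cases "q = 0")
    case False
    with q have "0 < q" by simp
    with y(1) have "ln q < y" by (simp add: elog_def)
    then have "exp (ln q) < exp y" by (rule exp_less_mono)
    then show ?thesis using \<open>0 < q\<close> by simp
  qed simp
  then have "\<forall>\<^sub>F s in sequentially. q + b ^ s < exp y"
    using pow by (rule order_tendstoD(2)[rotated])
  then have "\<forall>\<^sub>F s in sequentially. 0 < s \<and> q + b ^ s < exp y"
    by (intro eventually_conj eventually_gt_at_top)
  \<comment> \<open>\<open>s\<close> is fixed before \<open>k\<close> grows, so it does not matter
    how fast \<open>C s\<close> grows with \<open>s\<close>.\<close>
  then obtain s where s: "0 < s" "q + b ^ s < exp y"
    using eventually_happens'[OF sequentially_bot] by blast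
  define r where "r = q + b ^ s"
  \<comment> \<open>Since \<open>b\<close> is positive, so is \<open>r\<close>, even for
    \<open>q = 0\<close>, and its logarithm is finite.\<close>
  have r: "0 < r" using q b by (simp add: r_def add_nonneg_pos)
  have "ln r < ln (exp y)" using s(2) r by (subst ln_less_cancel_iff) (auto simp: r_def)
  then have "ln r < y" by simp
  have "(\<lambda>k. ln (C s) / real k + ln r) \<longlonglongrightarrow> ln r"
    using tendsto_add[OF lim_const_over_n[of "ln (C s)"] tendsto_const[of "ln r"]] by simp
  then have "\<forall>\<^sub>F k in sequentially. ln (C s) / real k + ln r < y"
    using \<open>ln r < y\<close> by (rule order_tendstoD(2))
  then show "\<forall>\<^sub>F k in sequentially. ereal (1 / real k) * elog (u k) < a"
    using eventually_ge_at_top[of 1]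
  proof eventually_elim
    case (elim k)
    have "ereal (1 / real k) * elog (u k) \<le> ereal (1 / real k) * elog (C s * r ^ k)"
      unfolding r_def by (rule ereal_mult_left_mono[OF elog_mono[OF upper[OF s(1) elim(2)]]]) simp
    also have "\<dots> = ereal (ln (C s) / real k + ln r)"
    proof -
      have "0 < C s * r ^ k" using C[OF s(1)] r by simp
      moreover have "ln (C s * r ^ k) = ln (C s) + real k * ln r"
        using C[OF s(1)] r by (simp add: ln_mult ln_realpow)
      ultimately have "ereal (1 / real k) * elog (C s * r ^ k)
          = ereal (1 / real k * (ln (C s) + real k * ln r))"
        by (simp add: elog_def)
      also have "1 / real k * (ln (C s) + real k * ln r) = ln (C s) / real k + ln r"
        using elim(2) by (simp add: divide_simps)
      finally show ?thesis .
    qed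
    also have "\<dots> < a"
      using elim(1) by (intro less_trans[OF _ y(2)]) simp
    finally show ?case .
  qed
qed

lemma has_consensus_rate_gossip:
  fixes W :: "nat \<Rightarrow> 'a \<Rightarrow> real ^ 'n ^ 'n"
  assumes gossip: "gossip_model M W \<delta> E"
    and attained: "D\<^sub>0 \<subseteq> E" "\<not> graph_connected (UNIV, D\<^sub>0)"
      "\<And>m. 1 \<le> m \<Longrightarrow> measure M {\<omega> \<in> space M. induced_graph (W m \<omega>) \<in> gossip_graphs D\<^sub>0} = q"
    and bound: "\<And>D m. D \<subseteq> E \<Longrightarrow> \<not> graph_connected (UNIV, D) \<Longrightarrow> 1 \<le> m \<Longrightarrow>
      measure M {\<omega> \<in> space M. induced_graph (W m \<omega>) \<in> gossip_graphs D} \<le> q"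
  shows "has_consensus_rate M W (- elog q)"
proof -
  interpret prob_space M
    using gossip by (simp add: gossip_model_def matrix_process_def iid_matrices_def)
  have ind: "indep_vars (\<lambda>_. borel) W {1..}" and \<delta>: "0 < \<delta>" and E: "E \<subseteq> {e. card e = 2}"
    and ae: "\<And>m. 1 \<le> m \<Longrightarrow> AE \<omega> in M. sym_doubly_stochastic (W m \<omega>) \<and> entries_bounded_below \<delta> (W m \<omega>)"
      "\<And>m. 1 \<le> m \<Longrightarrow> AE \<omega> in M. induced_graph (W m \<omega>) \<in> gossip_graphs E"
    using gossip by (auto simp: gossip_model_def matrix_process_def iid_matrices_def)
  have W: "W m \<in> borel_measurable M" if "1 \<le> m" for m
    using ind that by (auto simp: indep_vars_def)
  have q: "0 \<le> q" "q \<le> 1" using attained(3)[of 1] by auto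
  \<comment> \<open>This makes \<open>\<eta> * real CARD('n) ^ 5\<close> equal to 1/2.\<close>
  define \<eta> where "\<eta> = 1 / (2 * real CARD('n) ^ 5)"
  have \<eta>: "0 < \<eta>" "\<eta> * real CARD('n) ^ 5 < 1" by (simp_all add: \<eta>_def)
  \<comment> \<open>The cap 1/2 keeps \<open>1 - c\<close> strictly between 0 and 1.\<close>
  define c where "c = min (\<delta> * \<eta>) (1 / 2)"
  have c: "0 < c" "c \<le> \<delta> * \<eta>" "c < 1" using \<delta> \<eta> by (auto simp: c_def)
  show ?thesis
    unfolding has_consensus_rate_def
  proof (intro conjI allI impI)
    show "0 \<le> - elog q" using q by (auto simp: elog_def)
    fix \<epsilon> :: real assume \<epsilon>: "0 < \<epsilon> \<and> \<epsilon> \<le> 1"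
    have "(\<lambda>k. ereal (1 / real k) * elog (prob {\<omega> \<in> space M.
        spectral_norm (matrix_product W k \<omega> - averaging_matrix) \<ge> \<epsilon>})) \<longlonglongrightarrow> elog q"
    proof (rule tendsto_elog_exponential_bounds[OF q(1), where b = "1 - c"
          and C = "\<lambda>s. real CARD('n) * ((real CARD('n) / \<epsilon>)\<^sup>2) ^ s"])
      fix s k :: nat assume s: "0 < s" and "1 \<le> k"
      have "(\<integral>\<^sup>+\<omega>. ennreal (deviation (W m \<omega> *v x) ^ s) \<partial>M)
          \<le> ennreal ((q + (1 - c) ^ s) * deviation x ^ s)" if "1 \<le> m" for m x
        using ae[OF that] c that
        by (intro nn_integral_deviation_step[OF prob_space_axioms W _ E bound \<delta> \<eta> _ _ s]) auto
      moreover have "0 \<le> q + (1 - c) ^ s" using q c by simp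
      ultimately show "prob {\<omega> \<in> space M. spectral_norm (matrix_product W k \<omega> - averaging_matrix) \<ge> \<epsilon>}
          \<le> real CARD('n) * ((real CARD('n) / \<epsilon>)\<^sup>2) ^ s * (q + (1 - c) ^ s) ^ k"
        using \<epsilon> by (intro prob_no_consensus_le[OF gossip]
            nn_integral_deviation_matrix_product[OF prob_space_axioms ind]) auto
    next
      fix k :: nat assume "1 \<le> k"
      then show "q ^ k \<le> prob {\<omega> \<in> space M.
          spectral_norm (matrix_product W k \<omega> - averaging_matrix) \<ge> \<epsilon>}"
        using \<epsilon> by (intro prob_no_consensus_ge[OF gossip attained]) auto
    qed (use c \<epsilon> in auto)
    then show "(\<lambda>k. ereal (1 / real k) * elog (prob {\<omega> \<in> space M.
        spectral_norm (matrix_product W k \<omega> - averaging_matrix) \<ge> \<epsilon>})) \<longlonglongrightarrow> - (- elog q)"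
      by simp
  qed
qed

text \<open>Link probabilities are read off at a single time, whereas the rate involves all times;
  equality of the laws bridges the two.\<close>

lemma iid_prob_eq:
  assumes "iid_matrices M W" "1 \<le> s" "1 \<le> t" "S \<in> sets borel"
  shows "measure M {\<omega> \<in> space M. W s \<omega> \<in> S} = measure M {\<omega> \<in> space M. W t \<omega> \<in> S}"
proof -
  interpret prob_space M using assms(1) by (simp add: iid_matrices_def)
  have "measure M {\<omega> \<in> space M. W m \<omega> \<in> S} = measure (distr M borel (W m)) S" if "1 \<le> m" for m
  proof -
    have "W m \<in> borel_measurable M"
      using assms(1) that by (auto simp: iid_matrices_def indep_vars_def)
    then show ?thesis
      using assms(4) by (subst measure_distr) (auto intro!: arg_cong[where f = "measure M"])
  qed
  moreover have "distr M borel (W s) = distr M borel (W t)"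
    using assms(1-3) unfolding iid_matrices_def by metis
  ultimately show ?thesis using assms(2,3) by simp
qed

theorem lemma17:
  fixes M :: "'a measure"
    and W :: "nat \<Rightarrow> 'a \<Rightarrow> real ^ 'n ^ 'n"
    and \<delta> :: real
    and E :: "'n set set"
    and P :: "real ^ 'n ^ 'n"
    and t :: nat
  assumes gossip: "gossip_model M W \<delta> E"
    and t: "1 \<le> t"
    and P_link: "\<And>i j. {i, j} \<in> E \<Longrightarrow> P $ i $ j = graph_prob M (W t) (UNIV, {{i, j}})"
    and P_diag: "\<And>i. P $ i $ i = 0"
    and P_nonlink: "\<And>i j. {i, j} \<notin> E \<Longrightarrow> P $ i $ j = 0"
  shows "p_max M (W t) (gossip_graphs E) = 1 - mincut UNIV E P
         \<and> has_consensus_rate M W (- elog (1 - mincut UNIV E P))"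
proof -
  interpret prob_space M
    using gossip by (simp add: gossip_model_def matrix_process_def iid_matrices_def)
  have iid: "iid_matrices M W" and E: "E \<subseteq> {e. card e = 2}"
    using gossip by (simp_all add: gossip_model_def matrix_process_def)
  have ae: "AE \<omega> in M. induced_graph (W t \<omega>) \<in> gossip_graphs E"
    using gossip t by (simp add: gossip_model_def)
  have Wt: "W t \<in> borel_measurable M"
    using iid t by (auto simp: iid_matrices_def indep_vars_def)
  \<comment> \<open>Common value of sums of link probabilities, of cut costs and of event
    probabilities.\<close>
  define pr where "pr D = prob {\<omega> \<in> space M. induced_graph (W t \<omega>) \<in> gossip_graphs D}" for D
  have sum_graph: "(\<Sum>e\<in>D. graph_prob M (W t) (UNIV, {e})) = pr D" for D
    unfolding pr_def by (rule sum_graph_prob[OF prob_space_axioms Wt])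
  have "edge_cost P e = graph_prob M (W t) (UNIV, {e})" if e: "e \<in> E" for e
  proof -
    obtain i j where "e = {i, j}" using E e by (auto simp: card_2_iff)
    then show ?thesis using P_link e by (intro edge_cost_eq) auto
  qed
  then have cost: "(\<Sum>e\<in>D. edge_cost P e) = pr D" if "D \<subseteq> E" for D
    unfolding sum_graph[symmetric] using that by (intro sum.cong) auto
  have pr_E: "pr E = 1"
    unfolding pr_def using ae measurable_induced_graph[OF Wt] by (subst prob_Collect_eq_1) auto
  \<comment> \<open>With no links the event behind \<open>pr E\<close> would be impossible, yet it
    has probability 1.\<close>
  then have "E \<noteq> {}" by (auto simp: pr_def gossip_graphs_def)
  then have empty: "\<not> graph_connected (UNIV :: 'n set, {})"
    using E not_graph_connected_empty by blast
  define q where "q = 1 - mincut UNIV E P"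
  have "(\<Sum>e\<in>E. edge_cost P e) = 1" using cost pr_E by simp
  note cut = mincut_complement[OF empty this, folded q_def]
  \<comment> \<open>\<open>D\<^sub>0\<close> is the complement of a minimum cut.\<close>
  obtain D\<^sub>0 where D\<^sub>0: "D\<^sub>0 \<subseteq> E" "\<not> graph_connected (UNIV, D\<^sub>0)" "pr D\<^sub>0 = q"
    using cut(1) cost by metis
  have bound: "pr D \<le> q" if "D \<subseteq> E" "\<not> graph_connected (UNIV, D)" for D
    using cut(2)[OF that] cost[OF that(1)] by simp
  have "p_max M (W t) (gossip_graphs E) = q"
    using D\<^sub>0 bound by (intro p_max_gossip_eq[of D\<^sub>0]) (auto simp: sum_graph)
  moreover have "prob {\<omega> \<in> space M. induced_graph (W m \<omega>) \<in> gossip_graphs D} = pr D" if "1 \<le> m" for m D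
    unfolding pr_def using iid_prob_eq[OF iid that t measurable_induced_graph_borel] by simp
  then have "has_consensus_rate M W (- elog q)"
    using D\<^sub>0 bound by (intro has_consensus_rate_gossip[OF gossip, of D\<^sub>0]) auto
  ultimately show ?thesis by (simp add: q_def)
qed

end
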